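(* Let $p$ be a prime, $n\ge 1$, $h\ge 0$ and $k$ integers with $p^h\mid n$ and $0<k\le p^h$. Let $k'$ be the least positive residue of $k$ modulo $p-1$ (so $1\le k'\le p-1$ and $k\equiv k'\pmod{p-1}$). If $p-1\mid n-k$, then $S(n,k)$ is an almost minimum zero case (AMZC) and $$\nu_p(S(n,k))=\frac{\sigma_p(k)-k'}{p-1}=\left\lfloor\frac{\sigma_p(k)-1}{p-1}\right\rfloor .$$
   Context: $S(n,k)$ is the Stirling number of the second kind; $\sigma_p(m)$ is the sum of the base $p$ digits of $m\ge 0$; $\nu_p$ is the $p$-adic valuation. Higher order Bernoulli polynomials $B_m^{(l)}(x)$ ($m\ge 0$, $l\in\mathbb Z$) are defined by $\left(\frac{t}{e^t-1}\right)^l e^{tx}=\sum_{m\ge 0}B_m^{(l)}(x)\frac{t^m}{m!}$; $B_m^{(l)}(x)$ is monic of degree $m$ with rational coefficients, and $B_m^{(l)}=B_m^{(l)}(0)$. The maximum pole (with respect to $p$) of a nonzero rational polynomial $f$ is the integer $M$ with $-M=\min_i \nu_p(a_i)$ over its coefficients $a_i$. For $n\ge k\ge 1$, let $M$ be the maximum pole of $B_{n-k}^{(-k)}(x)$. $S(n,k)$ is an almost minimum zero case (AMZC) if $\nu_p(S(n,k))=\nu_p\left(\binom nk\right)-M$ (equivalently $\nu_p(B_{n-k}^{(-k)})=-M$, since $S(n,k)=\binom nk B_{n-k}^{(-k)}$). *)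

theory Defs
  imports
    "HOL-Computational_Algebra.Computational_Algebra"
    "HOL-Combinatorics.Stirling"
    "HOL-Number_Theory.Cong"
begin

text \<open>
  On positive integers the $p$-adic valuation is \<^const>\<open>multiplicity\<close>. The following is its
  extension to the rationals; its value at 0 is a dummy value and is never used.
\<close>

definition padic_val :: "nat \<Rightarrow> rat \<Rightarrow> int" where
  "padic_val p x =
     int (multiplicity (int p) (fst (quotient_of x))) -
     int (multiplicity (int p) (snd (quotient_of x)))"

text \<open>
  The sum runs over all base-\<open>p\<close> digits of \<open>m\<close> for \<open>p \<ge> 2\<close>, since the digits at
  positions \<open>i \<ge> m\<close> vanish because of \<open>m < p ^ m\<close>.
\<close>

definition digit_sum :: "nat \<Rightarrow> nat \<Rightarrow> nat" where
  "digit_sum p m = (\<Sum>i<m. m div p ^ i mod p)"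

text \<open>
  The generating function $(t/(e^t-1))^l\,e^{tx}$ is a power series in \<open>t\<close> over the
  polynomial ring in \<open>x\<close>. Its first factor is formed over the rationals, where \<open>fps_X\<close>
  cancels in the quotient and the result is an invertible series, so that the
  integer power \<open>powi\<close> is the usual one also for negative exponents.
\<close>

definition bernoulli_factor :: "int \<Rightarrow> rat fps" where
  "bernoulli_factor l = (fps_X / (fps_exp 1 - 1)) powi l"

definition bernoulli_gf :: "int \<Rightarrow> rat poly fps" where
  "bernoulli_gf l =
     Abs_fps (\<lambda>j. [:fps_nth (bernoulli_factor l) j:]) *
     Abs_fps (\<lambda>j. monom (1 / fact j) j)"

definition bernoulli_poly :: "int \<Rightarrow> nat \<Rightarrow> rat poly" where
  "bernoulli_poly l m = smult (fact m) (fps_nth (bernoulli_gf l) m)"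

lemma bernoulli_poly_gf:
  "Abs_fps (\<lambda>m. poly (bernoulli_poly l m) x / fact m) =
     (fps_X / (fps_exp 1 - 1)) powi l * fps_exp x"
  by (rule fps_ext)
    (simp add: bernoulli_poly_def bernoulli_gf_def bernoulli_factor_def fps_mult_nth
      poly_sum poly_monom mult_ac)

text \<open>Zero coefficients have infinite valuation and do not contribute to the minimum.\<close>

definition max_pole :: "nat \<Rightarrow> rat poly \<Rightarrow> int" where
  "max_pole p f = - Min ((\<lambda>i. padic_val p (coeff f i)) ` {i. coeff f i \<noteq> 0})"

definition AMZC :: "nat \<Rightarrow> nat \<Rightarrow> nat \<Rightarrow> bool" where
  "AMZC p n k \<longleftrightarrow>
     1 \<le> k \<and> k \<le> n \<and>
     int (multiplicity p (Stirling n k)) =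
       int (multiplicity p (n choose k)) - max_pole p (bernoulli_poly (- int k) (n - k))"

end

theory Submission
  imports "HOL-Number_Theory.Residues" Defs
begin

text \<open>
  Let \<open>E\<close> be the unit shift of polynomials in \<open>x\<close> and $\Delta = E - 1$. The coefficients of
  $\Delta^k x^n$ are $k!\binom ni S(n-i,k)$, so with $q = \lfloor (k-1)/(p-1) \rfloor$ the claim is
  that $p^q$ divides all of them and that $p^{q+1}$ does not divide the constant one. If $x^n$ were
  periodic modulo \<open>p\<close>, then $(1+\Delta)^p = 1$ would give $\Delta^p = -p\,\Delta\,u$ with
  $u = 1 + \Delta(\ldots)$, and hence $\Delta^k x^n = (-p)^q \Delta^{k_0} u^q x^n$ with
  $k_0 = k - (p-1)q$; the value at 0 is, up to the factor $(-p)^q$, congruent to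
  $\Delta^{k_0} x^{k_0} = k_0!$ modulo \<open>p\<close>, because $n \equiv k_0$ modulo $p-1$. In general
  $D = E^p - 1$ does not vanish, but since $p^h$ divides \<open>n\<close> and $k \le p^h$, the powers $D^s x^n$ are so
  divisible by \<open>p\<close> that all terms containing \<open>D\<close> vanish modulo $p^{q+1}$. Dividing by $k!$ and
  Legendre's formula turn \<open>q\<close> into the stated digit sum expression.
\<close>

subsection \<open>Digit sums and factorials\<close>

lemma digit_sum_eq_sum:
  assumes "p \<ge> 2" "m \<le> N"
  shows "digit_sum p m = (\<Sum>i<N. m div p ^ i mod p)"
proof -
  have "m div p ^ i = 0" if "m \<le> i" for i
  proof -
    have "m < p ^ m" using assms(1) by (simp add: power_gt_expt)
    also have "\<dots> \<le> p ^ i" using that assms(1) by (simp add: power_increasing)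
    finally show ?thesis by simp
  qed
  then show ?thesis
    unfolding digit_sum_def using assms(2) by (intro sum.mono_neutral_left) auto
qed

lemma digit_sum_div:
  assumes "p \<ge> 2"
  shows "digit_sum p m = m mod p + digit_sum p (m div p)"
proof -
  have "digit_sum p m = (\<Sum>i<Suc m. m div p ^ i mod p)"
    using assms by (intro digit_sum_eq_sum) auto
  also have "\<dots> = m mod p + (\<Sum>i<m. m div p div p ^ i mod p)"
    by (subst sum.lessThan_Suc_shift) (simp add: div_mult2_eq)
  also have "(\<Sum>i<m. m div p div p ^ i mod p) = digit_sum p (m div p)"
    using assms by (intro digit_sum_eq_sum [symmetric]) auto
  finally show ?thesis .
qed

lemma digit_sum_mult_add:
  assumes "p \<ge> 2" "d < p"
  shows "digit_sum p (p * t + d) = digit_sum p t + d"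
  using assms digit_sum_div [of p "p * t + d"] by simp

lemma digit_sum_le:
  assumes "p \<ge> 2" "m < p ^ L"
  shows "digit_sum p m \<le> (p - 1) * L"
  using assms(2)
proof (induction L arbitrary: m)
  case 0
  then show ?case by (simp add: digit_sum_def)
next
  case (Suc L)
  have "m div p < p ^ L"
    using Suc.prems assms(1) by (simp add: less_mult_imp_div_less mult.commute)
  from Suc.IH [OF this] have "digit_sum p (m div p) \<le> (p - 1) * L" .
  moreover have "m mod p \<le> p - 1" using assms(1) by (simp add: less_Suc_eq_le [symmetric])
  ultimately show ?case using assms(1) by (subst digit_sum_div) auto
qed

lemma Suc_eq_mult_Suc_div:
  assumes "0 < (p::nat)" "m mod p = p - 1"
  shows "Suc m = p * Suc (m div p)"
  using assms mult_div_mod_eq [of p m] by simp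

text \<open>Below p^L the bound of \<open>digit_sum_le\<close> is attained only by p^L - 1. A last
  digit p - 1 passes the question on to \<open>m div p\<close>; any smaller last digit already makes
  the inequality strict.\<close>

lemma digit_sum_less:
  assumes "p \<ge> 2" "Suc m < p ^ L"
  shows "digit_sum p m < (p - 1) * L"
  using assms(2)
proof (induction L arbitrary: m)
  case 0
  then show ?case by simp
next
  case (Suc L)
  have d: "m mod p < p" using assms(1) by simp
  have ds: "digit_sum p m = m mod p + digit_sum p (m div p)"
    using assms(1) by (rule digit_sum_div)
  show ?case
  proof (cases "m mod p = p - 1")
    case True
    then have "Suc m = p * Suc (m div p)"
      using assms(1) by (intro Suc_eq_mult_Suc_div) simp_all
    then have "p * Suc (m div p) < p * p ^ L" using Suc.prems by simp
    then have "Suc (m div p) < p ^ L" by (simp only: mult_less_cancel1)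
    from Suc.IH [OF this] show ?thesis using True ds by simp
  next
    case False
    have "m div p < p ^ L"
      using Suc.prems assms(1) by (simp add: less_mult_imp_div_less mult.commute)
    then have "digit_sum p (m div p) \<le> (p - 1) * L"
      using assms(1) by (intro digit_sum_le)
    then show ?thesis using False d ds by simp
  qed
qed

text \<open>Adding 1 turns the trailing digits p - 1 into zeros and raises the next digit by 1; the
  number of those trailing digits is the valuation of m + 1.\<close>

lemma digit_sum_Suc:
  assumes "prime p"
  shows "digit_sum p (Suc m) + (p - 1) * multiplicity p (Suc m) = Suc (digit_sum p m)"
proof (induction m rule: less_induct)
  case (less m)
  have p2: "p \<ge> 2" using assms by (rule prime_ge_2_nat)
  have d: "m mod p < p" using p2 by simp
  have ds: "digit_sum p m = digit_sum p (m div p) + m mod p"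
    using p2 by (subst digit_sum_div) auto
  show ?case
  proof (cases "m mod p = p - 1")
    case True
    then have S: "Suc m = p * Suc (m div p)"
      using p2 by (intro Suc_eq_mult_Suc_div) simp_all
    have "m div p < m"
    proof (rule div_less_dividend)
      show "0 < m" using True p2 by (cases m) auto
    qed (use p2 in simp)
    then have IH: "digit_sum p (Suc (m div p)) + (p - 1) * multiplicity p (Suc (m div p))
        = Suc (digit_sum p (m div p))"
      by (rule less.IH)
    have "multiplicity p (Suc m) = Suc (multiplicity p (Suc (m div p)))"
      unfolding S using assms by (intro multiplicity_times_same) auto
    moreover have "digit_sum p (Suc m) = digit_sum p (Suc (m div p))"
      unfolding S using digit_sum_mult_add [OF p2, of 0 "Suc (m div p)"] p2
      by (simp del: mult_Suc_right)
    ultimately show ?thesis using IH True ds by simp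
  next
    case False
    then have *: "Suc m = p * (m div p) + Suc (m mod p)" "Suc (m mod p) < p"
      using d by auto
    then have "\<not> p dvd Suc m"
      by (metis dvd_add_right_iff dvd_triv_left nat_dvd_not_less zero_less_Suc)
    moreover have "digit_sum p (Suc m) = digit_sum p (m div p) + Suc (m mod p)"
      using * digit_sum_mult_add [OF p2] by metis
    ultimately show ?thesis using ds by (simp add: not_dvd_imp_multiplicity_0)
  qed
qed

text \<open>Legendre's formula, obtained by summing the digit changes of
  \<open>digit_sum_Suc\<close>.\<close>

lemma multiplicity_fact_digit_sum:
  assumes "prime p"
  shows "(p - 1) * multiplicity p (fact m :: nat) + digit_sum p m = m"
proof (induction m)
  case 0
  then show ?case by (simp add: digit_sum_def)
next
  case (Suc m)
  have "multiplicity p (fact (Suc m) :: nat) =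
      multiplicity p (Suc m) + multiplicity p (fact m :: nat)"
    using assms by (simp add: prime_elem_multiplicity_mult_distrib del: mult_Suc)
  then show ?case using Suc digit_sum_Suc [OF assms, of m]
    by (simp add: algebra_simps)
qed

subsection \<open>Finite differences and power moments\<close>

text \<open>The operator X d/dX, which multiplies X^j by j. The variable X stands for the shift
  E.\<close>

definition euler_op :: "int poly \<Rightarrow> int poly" where
  "euler_op P = pCons 0 (pderiv P)"

text \<open>The \<open>m\<close>-th power moment, $\sum_j P_j\, j^m$.\<close>
definition moment :: "nat \<Rightarrow> int poly \<Rightarrow> int" where
  "moment m P = poly ((euler_op ^^ m) P) 1"

lemma euler_op_add: "euler_op (P + Q) = euler_op P + euler_op Q"
  by (simp add: euler_op_def pderiv_add)

lemma euler_op_smult: "euler_op (smult c P) = Polynomial.smult c (euler_op P)"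
  by (simp add: euler_op_def pderiv_smult)

lemma moment_0 [simp]: "moment 0 P = poly P 1"
  by (simp add: moment_def)

lemma moment_Suc: "moment (Suc m) P = moment m (euler_op P)"
  by (simp add: moment_def funpow_Suc_right del: funpow.simps)

lemma moment_add: "moment m (P + Q) = moment m P + moment m Q"
  by (induction m arbitrary: P Q) (simp_all add: moment_Suc euler_op_add)

lemma moment_smult: "moment m (smult c P) = c * moment m P"
  by (induction m arbitrary: P) (simp_all add: moment_Suc euler_op_smult)

lemma moment_diff: "moment m (P - Q) = moment m P - moment m Q"
  using moment_add [of m "P - Q" Q] by simp

lemma moment_zero [simp]: "moment m 0 = 0"
  using moment_smult [of m 0 0] by simp

lemma moment_sum: "moment m (\<Sum>i\<in>A. f i) = (\<Sum>i\<in>A. moment m (f i))"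
  by (induction A rule: infinite_finite_induct) (simp_all add: moment_add)

lemma moment_monom: "moment m (monom c j) = c * int j ^ m"
proof (induction m arbitrary: c)
  case 0
  then show ?case by (simp add: poly_monom)
next
  case (Suc m)
  have "euler_op (monom c j) = monom (int j * c) j"
    by (cases j) (auto simp: euler_op_def pderiv_monom simp flip: monom_Suc)
  then show ?case using Suc by (simp add: moment_Suc)
qed

lemma moment_eq_sum: "moment m P = (\<Sum>j\<le>degree P. coeff P j * int j ^ m)"
  by (subst poly_as_sum_of_monoms [symmetric]) (simp only: moment_sum moment_monom)

text \<open>Multiplication by X replaces j by j + 1, and (j + 1)^m expands binomially; in the
  induction this appears as Pascal's rule.\<close>

lemma moment_pCons_0: "moment m (pCons 0 P) = (\<Sum>l\<le>m. int (m choose l) * moment l P)"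
proof (induction m arbitrary: P)
  case 0
  then show ?case by simp
next
  case (Suc m)
  have "euler_op (pCons 0 P) = pCons 0 (P + euler_op P)"
    by (simp add: euler_op_def pderiv_pCons)
  then have "moment (Suc m) (pCons 0 P) =
      (\<Sum>l\<le>m. int (m choose l) * moment l P) + (\<Sum>l\<le>m. int (m choose l) * moment (Suc l) P)"
    by (simp add: moment_Suc Suc moment_add algebra_simps sum.distrib)
  also have "(\<Sum>l\<le>m. int (m choose l) * moment l P) =
      moment 0 P + (\<Sum>l\<le>m. int (m choose Suc l) * moment (Suc l) P)"
    using sum.atMost_Suc_shift [of "\<lambda>l. int (m choose l) * moment l P" m] by (simp add: binomial_eq_0)
  finally show ?case
    by (simp only: sum.atMost_Suc_shift binomial_Suc_Suc)
      (simp add: algebra_simps sum.distrib del: sum.atMost_Suc)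
qed

text \<open>This is the s-th difference of x^m at 0. The operator X d/dX maps (X-1)^s to s ((X-1)^s
  + (X-1)^(s-1)), which is the Stirling recurrence up to factorials.\<close>

lemma moment_diff_power: "moment m ([:- 1, 1:] ^ s) = fact s * int (Stirling m s)"
proof (induction m arbitrary: s)
  case 0
  then show ?case by (cases s) simp_all
next
  case (Suc m)
  show ?case
  proof (cases s)
    case 0
    then show ?thesis using moment_monom [of "Suc m" 1 0] by simp
  next
    case (Suc s')
    have "euler_op ([:- 1, 1:] ^ Suc s') =
        smult (int (Suc s')) ([:- 1, 1:] ^ Suc s' + [:- 1, 1:] ^ s')"
    proof -
      have "pderiv ([:- 1, 1:] ^ Suc s') = smult (int (Suc s')) ([:- 1, 1:] ^ s')"
        by (simp only: pderiv_power_Suc) (simp add: pderiv_pCons)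
      then show ?thesis by (simp add: euler_op_def pCons_eq_iff smult_add_right)
    qed
    then show ?thesis unfolding Suc
      by (simp add: moment_Suc moment_smult moment_add Suc.IH algebra_simps del: power_Suc)
  qed
qed

lemma moment_pcompose_monom: "moment m (pcompose P (monom 1 d)) = int d ^ m * moment m P"
proof (induction m arbitrary: P)
  case 0
  then show ?case by (simp add: poly_pcompose poly_monom)
next
  case (Suc m)
  have "euler_op (pcompose P (monom 1 d)) = smult (int d) (pcompose (euler_op P) (monom 1 d))"
  proof (cases d)
    case (Suc e)
    have "pderiv (monom 1 (Suc e)) = smult (int (Suc e)) (monom 1 e)"
      by (simp add: pderiv_monom smult_monom)
    then show ?thesis
      by (simp only: Suc euler_op_def pderiv_pcompose pcompose_pCons)
        (simp add: monom_Suc mult.commute)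
  qed (simp add: euler_op_def pderiv_pcompose pderiv_monom pcompose_pCons)
  then show ?case using Suc by (simp add: moment_Suc moment_smult)
qed

lemma moment_pcompose_power_minus_1:
  "moment m (([:0, 1:] ^ d - 1) ^ s) = int d ^ m * (fact s * int (Stirling m s))"
proof -
  have "([:0, 1:] ^ d - 1) ^ s = pcompose ([:- 1, 1 :: int:] ^ s) (monom 1 d)"
  proof (induction s)
    case (Suc s)
    then show ?case
      by (simp only: power_Suc pcompose_mult) (simp add: pcompose_pCons monom_altdef one_pCons)
  qed (simp add: pcompose_1)
  then show ?thesis by (simp only: moment_pcompose_monom moment_diff_power)
qed

text \<open>
  The polynomial $\sum_j P_j (x+j)^n$ has the coefficients $\binom nr \sum_j P_j\,j^r$; here all
  of them are required to be divisible by \<open>a\<close>. For $P = (X-1)^k$ this polynomial is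
  $k!\binom nk B_{n-k}^{(-k)}(x)$.
\<close>
definition shifts_dvd :: "nat \<Rightarrow> int \<Rightarrow> int poly \<Rightarrow> bool" where
  "shifts_dvd n a P \<longleftrightarrow> (\<forall>r. a dvd int (n choose r) * moment r P)"

lemma shifts_dvd_add: "shifts_dvd n a P \<Longrightarrow> shifts_dvd n a Q \<Longrightarrow> shifts_dvd n a (P + Q)"
  by (simp add: shifts_dvd_def moment_add algebra_simps)

lemma shifts_dvd_smult: "shifts_dvd n a P \<Longrightarrow> shifts_dvd n (c * a) (smult c P)"
  by (simp add: shifts_dvd_def moment_smult mult.left_commute)

lemma shifts_dvd_dvd: "shifts_dvd n a P \<Longrightarrow> b dvd a \<Longrightarrow> shifts_dvd n b P"
  unfolding shifts_dvd_def using dvd_trans by blast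

lemma shifts_dvd_1 [simp]: "shifts_dvd n 1 P"
  by (simp add: shifts_dvd_def)

lemma shifts_dvd_smult': "shifts_dvd n a P \<Longrightarrow> shifts_dvd n a (smult c P)"
  using shifts_dvd_smult shifts_dvd_dvd dvd_triv_right by blast

lemma shifts_dvd_diff: "shifts_dvd n a P \<Longrightarrow> shifts_dvd n a Q \<Longrightarrow> shifts_dvd n a (P - Q)"
  using shifts_dvd_add [of n a P "smult (- 1) Q"] shifts_dvd_smult' [of n a Q "- 1"] by simp

text \<open>Multiplication by X translates x to x + 1, which preserves divisibility of all
  coefficients. In terms of moments this rests on C(n,r) C(r,l) = C(n,l) C(n-l,r-l).\<close>

lemma shifts_dvd_pCons_0:
  assumes "shifts_dvd n a P"
  shows "shifts_dvd n a (pCons 0 P)"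
  unfolding shifts_dvd_def
proof
  fix r
  show "a dvd int (n choose r) * moment r (pCons 0 P)"
  proof (cases "r \<le> n")
    case True
    have "int (n choose r) * moment r (pCons 0 P) =
        (\<Sum>l\<le>r. int ((n - l) choose (r - l)) * (int (n choose l) * moment l P))"
      unfolding moment_pCons_0 sum_distrib_left
    proof (intro sum.cong refl)
      fix l assume "l \<in> {..r}"
      then have "int (n choose r) * int (r choose l) = int (n choose l) * int ((n - l) choose (r - l))"
        using choose_mult [of l r n] True by (simp flip: of_nat_mult)
      then show "int (n choose r) * (int (r choose l) * moment l P) =
          int ((n - l) choose (r - l)) * (int (n choose l) * moment l P)"
        by (simp flip: mult.assoc)
    qed
    also have "a dvd \<dots>"
      using assms by (intro dvd_sum) (simp add: shifts_dvd_def)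
    finally show ?thesis .
  qed (simp add: binomial_eq_0)
qed

text \<open>The polynomials with \<open>shifts_dvd n a\<close> form an ideal, so arbitrary cofactors
  such as u may be carried along.\<close>

lemma shifts_dvd_mult: "shifts_dvd n a P \<Longrightarrow> shifts_dvd n a (P * Q)"
proof (induction Q)
  case 0
  then show ?case by (simp add: shifts_dvd_def)
next
  case (pCons c Q)
  then show ?case
    by (simp add: mult_pCons_right shifts_dvd_add shifts_dvd_smult' shifts_dvd_pCons_0)
qed

section \<open>Divisibility of the powers of D = E^p - 1\<close>

lemma one_plus_power_prime:
  fixes y :: "'a::comm_ring_1"
  assumes "prime p"
  shows "\<exists>g. (1 + y) ^ p = 1 + y ^ p + of_nat p * (y * (1 + y * g))"
proof -
  have p2: "p \<ge> 2" using assms by (rule prime_ge_2_nat)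
  \<comment> \<open>The terms with 1 < i < p, divided by p y^2. The term i = 1 is kept apart: it
    gives the leading 1 in 1 + y g.\<close>
  define g where "g = (\<Sum>i\<in>{2..<p}. of_nat ((p choose i) div p) * y ^ (i - 2))"
  have "(1 + y) ^ p = (\<Sum>i\<le>p. of_nat (p choose i) * y ^ i)"
    using binomial_ring [of y 1 p] by (simp add: add.commute)
  also have "{..p} = insert 0 (insert 1 (insert p {2..<p}))"
    using p2 by auto
  also have "(\<Sum>i\<in>\<dots>. of_nat (p choose i) * y ^ i) =
      1 + (of_nat p * y + (y ^ p + (\<Sum>i\<in>{2..<p}. of_nat (p choose i) * y ^ i)))"
    using p2 by simp
  also have "(\<Sum>i\<in>{2..<p}. of_nat (p choose i) * y ^ i) = of_nat p * (y * (y * g))"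
    unfolding g_def sum_distrib_left
  proof (intro sum.cong refl)
    fix i assume i: "i \<in> {2..<p}"
    then have "p dvd (p choose i)"
      using assms by (intro dvd_choose_prime) auto
    then have "(p choose i) = p * ((p choose i) div p)" by simp
    then have "(of_nat (p choose i) :: 'a) = of_nat p * of_nat ((p choose i) div p)"
      by (metis of_nat_mult)
    moreover have "i = Suc (Suc (i - 2))" using i by auto
    then have "y ^ i = y * (y * y ^ (i - 2))" by (metis power_Suc)
    ultimately show "of_nat (p choose i) * y ^ i =
        of_nat p * (y * (y * (of_nat ((p choose i) div p) * y ^ (i - 2))))"
      by (simp add: mult_ac)
  qed
  finally have "(1 + y) ^ p = 1 + y ^ p + of_nat p * (y * (1 + y * g))"
    by (simp add: algebra_simps)
  then show ?thesis ..
qed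

lemma Stirling_Suc_same: "2 * Stirling (Suc s) s = s * Suc s"
proof (induction s)
  case (Suc s)
  have "2 * Stirling (Suc (Suc s)) (Suc s) = 2 * Suc s + 2 * Stirling (Suc s) s"
    by (subst Stirling.simps) (simp del: Stirling.simps)
  then show ?case using Suc by simp
qed simp

text \<open>Legendre's formula, multiplied by p - 1, turns a comparison of exponents into one of
  digit sums. The strict inequality with \<open>Suc h\<close> suffices because the exponents are
  integers.\<close>

lemma prime_power_dvd_mult_fact:
  assumes "prime p" "p ^ h dvd a" "(p - 1) * e + digit_sum p m < (p - 1) * Suc h + m"
  shows "p ^ e dvd a * fact m"
proof -
  have "(p - 1) * Suc (h + multiplicity p (fact m :: nat)) =
      (p - 1) * Suc h + (p - 1) * multiplicity p (fact m :: nat)"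
    by (simp only: add_Suc [symmetric] distrib_left)
  with assms(3) multiplicity_fact_digit_sum [OF assms(1), of m]
  have "(p - 1) * e < (p - 1) * Suc (h + multiplicity p (fact m :: nat))"
    by linarith
  then have "e \<le> h + multiplicity p (fact m :: nat)"
    by (simp only: mult_less_cancel1 less_Suc_eq_le)
  then have "p ^ e dvd p ^ h * p ^ multiplicity p (fact m :: nat)"
    by (metis le_imp_power_dvd power_add)
  also have "\<dots> dvd a * fact m"
    using assms(2) by (intro mult_dvd_mono multiplicity_dvd)
  finally show ?thesis .
qed

text \<open>
  Only the cases \<open>r = s\<close> and \<open>r = s + 1\<close> need the precise digit count; for larger \<open>r\<close> the factor
  $p^r$ coming from the step size \<open>p\<close> already suffices.
\<close>
lemma shifts_dvd_X_power_minus_1: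
  fixes p :: nat
  defines "q \<equiv> \<lambda>s. (s - 1) div (p - 1)"
  assumes p: "prime p" and n: "p ^ Suc g dvd n" and s: "0 < s" "s \<le> p ^ g"
    and IH: "shifts_dvd n (int p ^ q s) ([:- 1, 1:] ^ s)"
  shows "shifts_dvd n (int p ^ (s + q s + 1)) (([:0, 1:] ^ p - 1) ^ s)"
    and "s < p ^ g \<Longrightarrow> shifts_dvd n (int p ^ (s + q s + 2)) (([:0, 1:] ^ p - 1) ^ s)"
proof -
  have p2: "p \<ge> 2" using p by (rule prime_ge_2_nat)
  obtain t where t: "s = Suc t" using s(1) by (cases s) auto
  have q: "(p - 1) * q s \<le> t" unfolding q_def t by simp
  have q': "(p - 1) * q s < s" using q t by simp
  have "t < p ^ g" using s(2) unfolding t by (simp only: Suc_le_eq)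
  with p2 have dst: "digit_sum p t \<le> (p - 1) * g" by (rule digit_sum_le)
  define c where "c r = (n choose r) * (fact s * Stirling r s)" for r
  have c_IH: "p ^ q s dvd c r" for r
    using IH unfolding shifts_dvd_def moment_diff_power c_def
    by (simp flip: int_dvd_int_iff)
  have c_less: "c r = 0" if "r < s" for r
    using that by (simp add: c_def)
  have c_s: "c s = n * fact t * (n - 1 choose t)"
  proof -
    have "c s = (Suc t * (n choose Suc t)) * fact t"
      by (simp add: c_def t algebra_simps)
    then show ?thesis by (simp only: binomial_absorption mult_ac)
  qed
  \<comment> \<open>Doubled because S(s+1,s) = s (s+1) / 2; the factor s + 1 is absorbed by the
    binomial coefficient, which releases n.\<close>
  have c_Suc: "2 * c (Suc s) = n * fact s * (n - 1 choose s) * s"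
  proof -
    have "2 * c (Suc s) = (n choose Suc s) * fact s * (2 * Stirling (Suc s) s)"
      by (simp only: c_def mult_ac)
    also have "\<dots> = (Suc s * (n choose Suc s)) * fact s * s"
      by (simp only: Stirling_Suc_same mult_ac)
    also have "Suc s * (n choose Suc s) = n * (n - 1 choose s)"
      by (rule binomial_absorption)
    finally show ?thesis by (simp only: mult_ac)
  qed
  \<comment> \<open>The step size p contributes \<open>p ^ r\<close>. For r \<ge> e the truncated
    difference \<open>e - r\<close> is 0 and nothing remains to be shown.\<close>
  have *: "shifts_dvd n (int p ^ e) (([:0, 1:] ^ p - 1) ^ s)"
    if "\<And>r. s \<le> r \<Longrightarrow> p ^ (e - r) dvd c r" for e
    unfolding shifts_dvd_def moment_pcompose_power_minus_1
  proof
    fix r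
    have "p ^ e dvd p ^ r * c r"
    proof (cases "s \<le> r")
      case True
      have "p ^ e dvd p ^ r * p ^ (e - r)"
        unfolding power_add [symmetric] by (intro le_imp_power_dvd) simp
      also have "\<dots> dvd p ^ r * c r"
        using that [OF True] by (intro mult_dvd_mono) auto
      finally show ?thesis .
    qed (simp add: c_less)
    then have "int (p ^ e) dvd int (p ^ r * c r)" by (simp only: int_dvd_int_iff)
    then show "int p ^ e dvd int (n choose r) * (int p ^ r * (fact s * int (Stirling r s)))"
      by (simp add: c_def mult_ac)
  qed
  show "shifts_dvd n (int p ^ (s + q s + 1)) (([:0, 1:] ^ p - 1) ^ s)"
  proof (rule *)
    fix r assume r: "s \<le> r"
    show "p ^ (s + q s + 1 - r) dvd c r"
    proof (cases "r = s")
      case True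
      have "p ^ (q s + 1) dvd n * fact t"
        using dst q p2 by (intro prime_power_dvd_mult_fact [OF p n]) simp
      then show ?thesis using True c_s by simp
    next
      case False
      then have "s + q s + 1 - r \<le> q s" using r by simp
      then show ?thesis using c_IH [of r] le_imp_power_dvd dvd_trans by blast
    qed
  qed
  \<comment> \<open>Now t + 1 < p^g, so the digit sum bound for t becomes strict; this yields the
    second extra factor p.\<close>
  assume sl: "s < p ^ g"
  then have dst': "digit_sum p t < (p - 1) * g"
    unfolding t using p2 by (intro digit_sum_less)
  have dss: "digit_sum p s \<le> (p - 1) * g"
    using sl p2 by (intro digit_sum_le)
  show "shifts_dvd n (int p ^ (s + q s + 2)) (([:0, 1:] ^ p - 1) ^ s)"
  proof (rule *)
    fix r assume r: "s \<le> r"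
    consider "r = s" | "r = Suc s" | "r \<ge> s + 2" using r by linarith
    then show "p ^ (s + q s + 2 - r) dvd c r"
    proof cases
      case 1
      have "p ^ (q s + 2) dvd n * fact t"
        using dst' q p2 by (intro prime_power_dvd_mult_fact [OF p n]) (simp add: algebra_simps)
      then show ?thesis using 1 c_s by simp
    next
      case 2
      have "p ^ (q s + 2) dvd n * fact s"
        using dss q' by (intro prime_power_dvd_mult_fact [OF p n]) (simp add: add_mult_distrib2)
      then have "p * p ^ (q s + 1) dvd 2 * c r"
        using dvd_mult2 [of "p ^ (q s + 2)" "n * fact s" "(n - 1 choose s) * s"] 2 c_Suc
        by (simp add: mult.assoc)
      \<comment> \<open>One factor p is to spare: for p = 2 it cancels the 2, and for odd p the 2 is
        coprime to p.\<close>
      then have "p ^ (q s + 1) dvd c r"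
      proof (cases "p = 2")
        case False
        then have "coprime p 2" using p two_is_prime_nat primes_coprime by blast
        then have "coprime (p ^ (q s + 1)) 2" by (simp only: coprime_power_left_iff simp_thms)
        then show ?thesis
          using \<open>p * p ^ (q s + 1) dvd 2 * c r\<close> dvd_mult_right coprime_dvd_mult_right_iff by blast
      qed simp
      then show ?thesis using 2 by simp
    next
      case 3
      then have "s + q s + 2 - r \<le> q s" using r by simp
      then show ?thesis using c_IH [of r] le_imp_power_dvd dvd_trans by blast
    qed
  qed
qed

section \<open>Reduction of (X-1)^k modulo p^(q+1)\<close>

lemma diff_1_div_add_self:
  assumes "0 < (a::nat)" "0 < d"
  shows "(a + d - 1) div d = (a - 1) div d + 1"
proof -
  have "a + d - 1 = (a - 1) + d" using assms(1) by simp
  then show ?thesis using assms(2) by (simp only: div_add_self2)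
qed

text \<open>Give D^s (X-1)^j the weight p s + j. A positive power of D gains one factor p beyond the
  exponent q of the weight. For j \<ge> p, replace (X-1)^p by D - p (X-1) u: the first term keeps
  the weight, the second loses p - 1, which its factor p compensates. For j < p the bounds on D^s
  suffice.\<close>

lemma shifts_dvd_mixed:
  fixes p :: nat
  defines "q \<equiv> \<lambda>s. (s - 1) div (p - 1)"
  assumes p: "prime p" and n: "p ^ h dvd n" and k: "k \<le> p ^ h"
    and u: "[:0, 1:] ^ p - 1 = [:- 1, 1:] ^ p + smult (int p) ([:- 1, 1:] * u)"
    and IH: "\<And>s. 0 < s \<Longrightarrow> s < k \<Longrightarrow> shifts_dvd n (int p ^ q s) ([:- 1, 1:] ^ s)"
  shows "0 < s \<Longrightarrow> p * s + j \<le> k \<Longrightarrow>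
    shifts_dvd n (int p ^ (q (p * s + j) + 1)) (([:0, 1:] ^ p - 1) ^ s * [:- 1, 1:] ^ j)"
proof (induction j arbitrary: s rule: less_induct)
  case (less j)
  have p2: "p \<ge> 2" using p by (rule prime_ge_2_nat)
  let ?D = "[:0, 1:] ^ p - 1 :: int poly" and ?Y = "[:- 1, 1:] :: int poly"
  have q_fold: "(a - 1) div (p - 1) = q a" for a by (simp add: q_def)
  have q_add: "q (a + (p - 1)) = q a + 1" if "a > 0" for a
    unfolding q_def using that p2 by (intro diff_1_div_add_self) auto
  have q_ps: "q (p * s + j) = s + q (s + j)"
  proof -
    have "p * s + j - 1 = (s + j - 1) + s * (p - 1)"
      using less.prems(1) p2 by (simp add: algebra_simps)
    then show ?thesis unfolding q_def using p2 by (simp only: div_mult_self1)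
  qed
  have "s > 0" by fact
  show ?case
  proof (cases "j < p")
    case True
    have "h \<noteq> 0"
    proof
      assume "h = 0"
      then have "p * s \<le> 1" using less.prems k by simp
      moreover have "p * 1 \<le> p * s" using \<open>s > 0\<close> by (intro mult_left_mono) auto
      ultimately show False using p2 by simp
    qed
    then obtain g where h: "h = Suc g" by (cases h) auto
    \<comment> \<open>Dividing by p bounds s by p^g, strictly if j > 0; the strict case gives access
      to the stronger bound on D^s.\<close>
    have "p * s + j \<le> p * p ^ g" using less.prems k h by simp
    then have "p * s \<le> p * p ^ g" "j > 0 \<Longrightarrow> p * s < p * p ^ g"
      by linarith+
    then have sg: "s \<le> p ^ g" "j > 0 \<Longrightarrow> s < p ^ g"
      using p2 by simp_all
    have sk: "s < k"
    proof -
      have "2 * s \<le> p * s" using p2 by (intro mult_right_mono) auto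
      then show ?thesis using less.prems by linarith
    qed
    note D = shifts_dvd_X_power_minus_1 [OF p n [unfolded h] \<open>s > 0\<close> sg(1)
      IH [OF \<open>s > 0\<close> sk, unfolded q_def], unfolded q_fold]
    show ?thesis
    proof (cases "j = 0")
      case True
      then show ?thesis using D(1) q_ps by simp
    next
      case False
      \<comment> \<open>The factor (X-1)^j raises the required exponent by at most 1, which the
        stronger bound covers.\<close>
      have "q (s + j) \<le> q (s + (p - 1))"
        unfolding q_def using \<open>j < p\<close> by (intro div_le_mono) auto
      then have "q (p * s + j) + 1 \<le> s + q s + 2"
        using q_ps q_add [OF \<open>s > 0\<close>] by simp
      then show ?thesis
        using sg(2) False
        by (intro shifts_dvd_mult shifts_dvd_dvd [OF D(2) le_imp_power_dvd]) auto
    qed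
  next
    case False
    define i where "i = j - p"
    have j: "j = i + p" using False by (simp add: i_def)
    have 1: "shifts_dvd n (int p ^ (q (p * s + j) + 1)) (?D ^ Suc s * ?Y ^ i)"
      using less.IH [of i "Suc s"] less.prems p2 by (simp add: j algebra_simps)
    have "shifts_dvd n (int p ^ (q (p * s + (i + 1)) + 1)) (?D ^ s * ?Y ^ (i + 1))"
      using less.IH [of "i + 1" s] less.prems p2 by (simp add: j)
    then have "shifts_dvd n (int p * int p ^ (q (p * s + (i + 1)) + 1))
        (smult (int p) (?D ^ s * ?Y ^ (i + 1) * u))"
      by (rule shifts_dvd_smult [OF shifts_dvd_mult])
    also have "q (p * s + (i + 1)) + 1 = q (p * s + j)"
      using q_add [of "p * s + (i + 1)"] j p2 by (simp add: algebra_simps)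
    finally have 2: "shifts_dvd n (int p ^ (q (p * s + j) + 1))
        (smult (int p) (?D ^ s * ?Y ^ (i + 1) * u))"
      by simp
    have "?D ^ s * ?Y ^ j = ?D ^ s * ?Y ^ i * ?Y ^ p"
      by (simp only: j power_add mult.assoc)
    also have "?Y ^ p = ?D - smult (int p) (?Y * u)"
      using u by (simp only: add_diff_cancel_right')
    also have "?D ^ s * ?Y ^ i * (?D - smult (int p) (?Y * u)) =
        ?D ^ Suc s * ?Y ^ i - smult (int p) (?D ^ s * ?Y ^ (i + 1) * u)"
      by (simp only: right_diff_distrib mult_smult_left mult_smult_right power_Suc power_add
        power_one_right mult_ac)
    finally show ?thesis using shifts_dvd_diff [OF 1 2] by (simp only:)
  qed
qed

text \<open>The case s = 1 of \<open>shifts_dvd_mixed\<close>: D (X-1)^(k-p) is negligible, so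
  (X-1)^k may be replaced by -p (X-1)^(k-(p-1)) u.\<close>

lemma shifts_dvd_reduce:
  fixes p :: nat
  defines "q \<equiv> \<lambda>s. (s - 1) div (p - 1)"
  assumes p: "prime p" and n: "p ^ h dvd n" and k: "k \<le> p ^ h"
    and u: "[:0, 1:] ^ p - 1 = [:- 1, 1:] ^ p + smult (int p) ([:- 1, 1:] * u)"
    and IH: "\<And>s. 0 < s \<Longrightarrow> s < k \<Longrightarrow> shifts_dvd n (int p ^ q s) ([:- 1, 1:] ^ s)"
    and "p \<le> k"
  shows "shifts_dvd n (int p ^ (q k + 1))
    ([:- 1, 1:] ^ k + smult (int p) ([:- 1, 1:] ^ (k - (p - 1)) * u))"
proof -
  have p2: "p \<ge> 2" using p by (rule prime_ge_2_nat)
  obtain i where i: "k = p + i" using \<open>p \<le> k\<close> le_Suc_ex by blast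
  have "k - (p - 1) = Suc i" using i p2 by simp
  moreover have "shifts_dvd n (int p ^ (q k + 1)) (([:0, 1:] ^ p - 1) * [:- 1, 1:] ^ i)"
    using shifts_dvd_mixed [OF p n k u, of 1 i] IH unfolding q_def by (simp add: i)
  ultimately show ?thesis
    unfolding u by (simp only: i power_add power_Suc distrib_left distrib_right mult_smult_left
      mult_smult_right mult_ac)
qed

text \<open>Strong induction supplies the hypothesis on smaller exponents. Each reduction lowers k
  by p - 1 and q by 1 and gives a factor p; for k < p the exponent q is 0.\<close>

lemma shifts_dvd_diff_power:
  fixes p :: nat
  defines "q \<equiv> \<lambda>s. (s - 1) div (p - 1)"
  assumes p: "prime p" and n: "p ^ h dvd n"
    and u: "[:0, 1:] ^ p - 1 = [:- 1, 1:] ^ p + smult (int p) ([:- 1, 1:] * u)"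
  shows "0 < k \<Longrightarrow> k \<le> p ^ h \<Longrightarrow> shifts_dvd n (int p ^ q k) ([:- 1, 1:] ^ k)"
proof (induction k rule: less_induct)
  case (less k)
  have p2: "p \<ge> 2" using p by (rule prime_ge_2_nat)
  let ?Y = "[:- 1, 1:] :: int poly"
  show ?case
  proof (cases "p \<le> k")
    case True
    have 1: "shifts_dvd n (int p ^ (q k + 1)) (?Y ^ k + smult (int p) (?Y ^ (k - (p - 1)) * u))"
      using shifts_dvd_reduce [OF p n less.prems(2) u _ True] less.IH less.prems
      unfolding q_def by simp
    have "shifts_dvd n (int p ^ q (k - (p - 1))) (?Y ^ (k - (p - 1)))"
      using less.IH less.prems True p2 by simp
    then have "shifts_dvd n (int p * int p ^ q (k - (p - 1)))
        (smult (int p) (?Y ^ (k - (p - 1)) * u))"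
      by (intro shifts_dvd_smult shifts_dvd_mult)
    moreover have "q k = Suc (q (k - (p - 1)))"
      unfolding q_def using diff_1_div_add_self [of "k - (p - 1)" "p - 1"] True p2 by simp
    ultimately have 2: "shifts_dvd n (int p ^ q k) (smult (int p) (?Y ^ (k - (p - 1)) * u))"
      by simp
    have "shifts_dvd n (int p ^ q k) (?Y ^ k + smult (int p) (?Y ^ (k - (p - 1)) * u))"
      by (rule shifts_dvd_dvd [OF 1]) simp
    from shifts_dvd_diff [OF this 2] show ?thesis by simp
  next
    case False
    then show ?thesis using less.prems by (simp add: q_def)
  qed
qed

text \<open>Iterating the reduction q times leaves one explicit term. An error divisible by
  p^(q(i)+1) at i = k - (p-1) gets multiplied by p, while q also grows by 1.\<close>

lemma shifts_dvd_leading_term: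
  fixes p :: nat
  defines "q \<equiv> \<lambda>s. (s - 1) div (p - 1)"
  assumes p: "prime p" and n: "p ^ h dvd n"
    and u: "[:0, 1:] ^ p - 1 = [:- 1, 1:] ^ p + smult (int p) ([:- 1, 1:] * u)"
  shows "0 < k \<Longrightarrow> k \<le> p ^ h \<Longrightarrow>
    shifts_dvd n (int p ^ (q k + 1))
      ([:- 1, 1:] ^ k - smult ((- int p) ^ q k) ([:- 1, 1:] ^ (k - (p - 1) * q k) * u ^ q k))"
proof (induction k rule: less_induct)
  case (less k)
  have p2: "p \<ge> 2" using p by (rule prime_ge_2_nat)
  let ?Y = "[:- 1, 1:] :: int poly"
  show ?case
  proof (cases "p \<le> k")
    case True
    define i where "i = k - (p - 1)"
    have i: "k = i + (p - 1)" "0 < i" using True p2 by (simp_all add: i_def)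
    have qk: "q k = Suc (q i)"
      unfolding q_def i(1) using i(2) p2 by (subst diff_1_div_add_self) auto
    have 1: "shifts_dvd n (int p ^ (q k + 1)) (?Y ^ k + smult (int p) (?Y ^ i * u))"
      using shifts_dvd_reduce [OF p n less.prems(2) u _ True] less.prems
        shifts_dvd_diff_power [OF p n u] unfolding q_def i_def by simp
    have "shifts_dvd n (int p ^ (q i + 1))
      (?Y ^ i - smult ((- int p) ^ q i) (?Y ^ (i - (p - 1) * q i) * u ^ q i))"
      using less.IH [of i] less.prems i p2 by simp
    then have 2: "shifts_dvd n (int p * int p ^ (q i + 1))
      (smult (int p) ((?Y ^ i - smult ((- int p) ^ q i) (?Y ^ (i - (p - 1) * q i) * u ^ q i)) * u))"
      by (intro shifts_dvd_smult shifts_dvd_mult)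
    have 3: "k - (p - 1) * q k = i - (p - 1) * q i"
      unfolding qk unfolding i(1) mult_Suc_right by simp
    have "?Y ^ k - smult ((- int p) ^ q k) (?Y ^ (k - (p - 1) * q k) * u ^ q k) =
      ?Y ^ k + smult (int p) (?Y ^ i * u) -
      smult (int p) ((?Y ^ i - smult ((- int p) ^ q i) (?Y ^ (i - (p - 1) * q i) * u ^ q i)) * u)"
      unfolding 3 unfolding qk
      by (simp add: left_diff_distrib smult_diff_right mult.assoc mult.commute [of u])
    moreover have eq: "int p * int p ^ (q i + 1) = int p ^ (q k + 1)"
      by (simp add: qk)
    ultimately show ?thesis
      using shifts_dvd_diff [OF 1 2 [unfolded eq]] by (simp only:)
  next
    case False
    then have "q k = 0" using less.prems by (simp add: q_def)
    then show ?thesis by (simp add: shifts_dvd_def)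
  qed
qed

section \<open>The leading term modulo p\<close>

lemma cong_power_prime_exponents:
  fixes a :: int
  assumes p: "prime p" and "0 < m" "m \<le> n" "(p - 1) dvd (n - m)"
  shows "[a ^ n = a ^ m] (mod int p)"
proof (cases "int p dvd a")
  case True
  then have "int p dvd a ^ m" "int p dvd a ^ n"
    using assms(2,3) by (auto intro: dvd_power_le dvd_trans [OF _ dvd_power])
  then show ?thesis by (metis cong_0_iff cong_sym cong_trans)
next
  case False
  obtain d where d: "n = m + (p - 1) * d" using assms(3,4) by (metis dvd_def le_add_diff_inverse)
  have "[a ^ (p - 1) = 1] (mod int p)"
  proof -
    \<comment> \<open>\<open>fermat_theorem\<close> speaks of natural numbers, so a enters through
      its nonnegative residue.\<close>
    have "[nat (a mod int p) ^ (p - 1) = 1] (mod p)"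
    proof (rule fermat_theorem [OF p])
      show "\<not> p dvd nat (a mod int p)"
        using False p prime_gt_0_nat [OF p]
        by (metis dvd_mod_iff int_dvd_int_iff dvd_refl nat_0_le pos_mod_sign of_nat_0_less_iff)
    qed
    then have "[int (nat (a mod int p) ^ (p - 1)) = int 1] (mod int p)"
      by (simp only: cong_int_iff)
    then have "[(a mod int p) ^ (p - 1) = 1] (mod int p)"
      using prime_gt_0_nat [OF p] by simp
    then show ?thesis by (simp add: cong_def power_mod)
  qed
  then have "[a ^ m * (a ^ (p - 1)) ^ d = a ^ m * 1 ^ d] (mod int p)"
    by (intro cong_mult cong_pow) auto
  then show ?thesis by (simp add: d power_add power_mult)
qed

text \<open>Divisor 0 expresses that the s-th difference of x^m is the zero polynomial; in this form
  the ideal property extends it to all multiples of (X-1)^s.\<close>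

lemma shifts_dvd_0_diff_power:
  assumes "m < s"
  shows "shifts_dvd m 0 ([:- 1, 1:] ^ s)"
  unfolding shifts_dvd_def moment_diff_power using assms
  by (metis Stirling_less binomial_eq_0 dvd_refl linorder_not_less mult_eq_0_iff of_nat_0
      order_less_le_trans)

lemma one_plus_mult_power:
  fixes y g :: "'a::comm_ring_1"
  shows "\<exists>g'. (1 + y * g) ^ q = 1 + y * g'"
proof (induction q)
  case 0
  then show ?case by (intro exI [of _ 0]) simp
next
  case (Suc q)
  then obtain g' where "(1 + y * g) ^ q = 1 + y * g'" by blast
  then have "(1 + y * g) ^ Suc q = 1 + y * (g + g' + y * g * g')"
    by (simp add: algebra_simps)
  then show ?case by blast
qed

lemma X_power_prime_minus_1:
  assumes "prime p"
  shows "\<exists>g. [:0, 1 :: int:] ^ p - 1 =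
    [:- 1, 1:] ^ p + smult (int p) ([:- 1, 1:] * (1 + [:- 1, 1:] * g))"
proof -
  obtain g where "(1 + [:- 1, 1 :: int:]) ^ p =
      1 + [:- 1, 1:] ^ p + of_nat p * ([:- 1, 1:] * (1 + [:- 1, 1:] * g))"
    using one_plus_power_prime [OF assms] by blast
  moreover have "1 + [:- 1, 1 :: int:] = [:0, 1:]" by (simp add: one_pCons)
  ultimately have "[:0, 1 :: int:] ^ p - 1 =
      [:- 1, 1:] ^ p + of_nat p * ([:- 1, 1:] * (1 + [:- 1, 1:] * g))"
    by (simp only: add.assoc add_diff_cancel_left')
  then show ?thesis by (auto simp: of_nat_poly)
qed

text \<open>General r is kept because every coefficient of the Bernoulli polynomial has to be
  bounded, not only the constant one.\<close>

lemma fact_mult_Stirling_dvd: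
  assumes "prime p" "p ^ h dvd n" "0 < k" "k \<le> p ^ h"
  shows "p ^ ((k - 1) div (p - 1)) dvd (n choose r) * (fact k * Stirling r k)"
proof -
  obtain g where "[:0, 1 :: int:] ^ p - 1 =
    [:- 1, 1:] ^ p + smult (int p) ([:- 1, 1:] * (1 + [:- 1, 1:] * g))"
    using X_power_prime_minus_1 [OF assms(1)] by blast
  from shifts_dvd_diff_power [OF assms(1,2) this assms(3,4)]
  show ?thesis
    unfolding shifts_dvd_def moment_diff_power by (simp flip: int_dvd_int_iff)
qed

text \<open>Otherwise, after cancelling p^q, p would divide the n-th moment of (X-1)^k' u^q. Fermat
  lowers the order n to k', where only (X-1)^k' survives, with moment k'!; but k' < p.\<close>

lemma not_dvd_fact_mult_Stirling:
  assumes p: "prime p" and n: "p ^ h dvd n" and k: "0 < k" "k \<le> p ^ h"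
    and kn: "k \<le> n" "(p - 1) dvd (n - k)"
  shows "\<not> p ^ Suc ((k - 1) div (p - 1)) dvd fact k * Stirling n k"
proof
  let ?Y = "[:- 1, 1:] :: int poly"
  define q where "q = (k - 1) div (p - 1)"
  define k' where "k' = k - (p - 1) * q"
  assume *: "p ^ Suc ((k - 1) div (p - 1)) dvd fact k * Stirling n k"
  have p2: "p \<ge> 2" using p by (rule prime_ge_2_nat)
  have mod_q: "(k - 1) mod (p - 1) = (k - 1) - (p - 1) * q" and q_le: "(p - 1) * q \<le> k - 1"
    unfolding q_def by (simp_all only: minus_mult_div_eq_mod times_div_less_eq_dividend)
  have k': "k' = (k - 1) mod (p - 1) + 1"
    using mod_q q_le k(1) unfolding k'_def by linarith
  moreover have "(k - 1) mod (p - 1) < p - 1" using p2 by simp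
  ultimately have "k' < p" "k' > 0" by linarith+
  obtain g where "[:0, 1 :: int:] ^ p - 1 = ?Y ^ p + smult (int p) (?Y * (1 + ?Y * g))"
    using X_power_prime_minus_1 [OF p] by blast
  \<comment> \<open>Used at r = n, where the binomial factor is 1.\<close>
  from shifts_dvd_leading_term [OF p n this k]
  have "int p ^ Suc q dvd
      moment n (?Y ^ k - smult ((- int p) ^ q) (?Y ^ k' * (1 + ?Y * g) ^ q))"
    unfolding shifts_dvd_def q_def k'_def by (auto dest: spec [of _ n])
  moreover obtain g' where g': "(1 + ?Y * g) ^ q = 1 + ?Y * g'"
    using one_plus_mult_power by blast
  moreover have "moment n (?Y ^ k - smult a P) =
      fact k * int (Stirling n k) - a * moment n P" for a P
    by (simp add: moment_diff moment_smult moment_diff_power)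
  ultimately have diff: "int p ^ Suc q dvd fact k * int (Stirling n k) -
      (- int p) ^ q * moment n (?Y ^ k' * (1 + ?Y * g'))"
    by simp
  have "int p ^ Suc q dvd fact k * int (Stirling n k)"
  proof -
    have "int (p ^ Suc q) dvd int (fact k * Stirling n k)"
      using * unfolding q_def int_dvd_int_iff .
    then show ?thesis by (simp only: of_nat_mult of_nat_power of_nat_fact)
  qed
  from dvd_diff [OF this diff]
  have "int p ^ Suc q dvd (- int p) ^ q * moment n (?Y ^ k' * (1 + ?Y * g'))"
    by (simp only: diff_diff_eq2 add_diff_cancel_left')
  then have "int p ^ q * int p dvd int p ^ q * ((- 1) ^ q * moment n (?Y ^ k' * (1 + ?Y * g')))"
    by (simp only: power_minus [of "int p" q] power_Suc mult_ac)
  then have "int p dvd (- 1) ^ q * moment n (?Y ^ k' * (1 + ?Y * g'))"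
    using p2 by (simp only: dvd_mult_cancel_left) simp
  then have "int p dvd moment n (?Y ^ k' * (1 + ?Y * g'))"
    by (cases "even q") simp_all
  \<comment> \<open>A moment is a combination of powers j^n; k' > 0 makes the congruence valid also
    for j divisible by p.\<close>
  moreover have "[moment n P = moment k' P] (mod int p)" for P
  proof -
    have "k - k' = (p - 1) * q" "k' \<le> k"
      unfolding k'_def using q_le by linarith+
    then have "n - k' = (n - k) + (p - 1) * q" "k' \<le> n" using kn by auto
    then have "(p - 1) dvd n - k'" using kn(2) by (metis dvd_add dvd_triv_left)
    then show ?thesis
      unfolding moment_eq_sum using \<open>k' \<le> n\<close> \<open>k' > 0\<close>
      by (intro cong_sum cong_mult cong_power_prime_exponents [OF p]) auto
  qed
  ultimately have "int p dvd moment k' (?Y ^ k' * (1 + ?Y * g'))"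
    using cong_dvd_iff by blast
  also have "?Y ^ k' * (1 + ?Y * g') = ?Y ^ k' + ?Y ^ Suc k' * g'"
    by (simp only: distrib_left power_Suc mult_1_right mult_ac)
  \<comment> \<open>The multiple of (X-1)^(k'+1) has vanishing moment of order k'.\<close>
  also have "moment k' \<dots> = fact k'"
    using shifts_dvd_mult [OF shifts_dvd_0_diff_power [of k' "Suc k'"], of g']
    by (auto simp: moment_add moment_diff_power shifts_dvd_def simp del: power_Suc
        dest: spec [of _ k'])
  finally have "p dvd (fact k' :: nat)"
    by (metis int_dvd_int_iff of_nat_fact)
  then show False
    using prime_dvd_fact_iff [OF p] \<open>k' < p\<close> by simp
qed

subsection \<open>Bernoulli polynomials of negative order\<close>

text \<open>The derivative of (e^t-1)^k is k ((e^t-1)^k + (e^t-1)^(k-1)), again the Stirling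
  recurrence.\<close>

lemma fps_exp_minus_1_power_nth:
  "fps_nth ((fps_exp (1 :: 'a :: field_char_0) - 1) ^ k) n = fact k * of_nat (Stirling n k) / fact n"
proof (induction n arbitrary: k)
  case 0
  then show ?case by (cases k) (simp_all add: fps_power_zeroth)
next
  case (Suc n)
  show ?case
  proof (cases k)
    case 0
    then show ?thesis by simp
  next
    case (Suc j)
    let ?E = "fps_exp (1 :: 'a)"
    have "fps_deriv ((?E - 1) ^ Suc j) =
        of_nat (Suc j) * ((?E - 1) ^ Suc j + (?E - 1) ^ j)"
    proof -
      have "(?E - 1) ^ Suc j + (?E - 1) ^ j = ?E * (?E - 1) ^ j"
        by (simp add: algebra_simps)
      then show ?thesis
        by (simp add: fps_deriv_power fps_of_nat [symmetric] mult.assoc del: power_Suc of_nat_Suc)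
    qed
    then have "of_nat (Suc n) * fps_nth ((?E - 1) ^ Suc j) (Suc n) =
        of_nat (Suc j) * (fps_nth ((?E - 1) ^ Suc j) n + fps_nth ((?E - 1) ^ j) n)"
      by (metis fps_deriv_nth fps_add_nth fps_mult_of_nat_nth(1) Suc_eq_plus1)
    then have "fact (Suc n) * fps_nth ((?E - 1) ^ k) (Suc n) = fact n * (of_nat (Suc j) *
        (fact (Suc j) * of_nat (Stirling n (Suc j)) / fact n + fact j * of_nat (Stirling n j) / fact n))"
      unfolding Suc Suc.IH by (simp add: mult_ac del: of_nat_Suc power_Suc)
    also have "\<dots> = fact k * of_nat (Stirling (Suc n) k)"
      by (simp add: Suc field_simps)
    finally show ?thesis by (simp add: field_simps del: fact_Suc)
  qed
qed

lemma bernoulli_factor_minus: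
  "fps_nth (bernoulli_factor (- int k)) j =
    fact k * of_nat (Stirling (j + k) k) / fact (j + k)"
proof -
  let ?E = "fps_exp (1 :: rat) - 1"
  \<comment> \<open>F = (e^t-1)/t has constant term 1, so t/(e^t-1) is its inverse and order -k
    gives the power F^k.\<close>
  define F where "F = fps_shift 1 ?E"
  have E: "?E = fps_X * F"
    unfolding F_def by (rule fps_ext) simp
  have F0: "fps_nth F 0 \<noteq> 0" by (simp add: F_def)
  have "fps_X = inverse F * ?E"
    unfolding E using inverse_mult_eq_1 [OF F0] by (simp add: mult.left_commute)
  moreover have "?E \<noteq> 0" using F0 E by auto
  ultimately have "fps_X / ?E = inverse F"
    by (metis nonzero_mult_div_cancel_right)
  then have "bernoulli_factor (- int k) = F ^ k"
    using F0
    by (simp add: bernoulli_factor_def power_int_def fps_inverse_power fps_inverse_idempotent)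
  moreover have "?E ^ k = fps_X ^ k * F ^ k"
    unfolding E by (rule power_mult_distrib)
  ultimately have "fps_nth (bernoulli_factor (- int k)) j = fps_nth (?E ^ k) (j + k)"
    by (simp add: fps_X_power_mult_nth)
  then show ?thesis by (simp add: fps_exp_minus_1_power_nth)
qed

lemma coeff_bernoulli_poly_minus:
  assumes "k \<le> n" "i \<le> n - k"
  shows "coeff (bernoulli_poly (- int k) (n - k)) i =
    of_nat ((n choose i) * Stirling (n - i) k) / of_nat (n choose k)"
proof -
  let ?m = "n - k"
  have "coeff (bernoulli_poly (- int k) ?m) i =
      fact ?m * (\<Sum>j\<le>?m. fps_nth (bernoulli_factor (- int k)) j *
        (if ?m - j = i then 1 / fact (?m - j) else 0))"
    unfolding bernoulli_poly_def bernoulli_gf_def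
    by (simp add: fps_mult_nth coeff_sum atLeast0AtMost cong: if_cong)
  also have "(\<Sum>j\<le>?m. fps_nth (bernoulli_factor (- int k)) j *
        (if ?m - j = i then 1 / fact (?m - j) else 0)) =
      (\<Sum>j\<le>?m. if j = ?m - i then fps_nth (bernoulli_factor (- int k)) j * (1 / fact i) else 0)"
    using assms by (intro sum.cong) auto
  also have "\<dots> = fps_nth (bernoulli_factor (- int k)) (?m - i) / fact i"
    by simp
  also have "?m - i + k = n - i" using assms by simp
  then have "fps_nth (bernoulli_factor (- int k)) (?m - i) =
      fact k * of_nat (Stirling (n - i) k) / fact (n - i)"
    by (simp add: bernoulli_factor_minus)
  finally show ?thesis
    using assms by (simp add: binomial_fact field_simps)
qed

section \<open>Valuations of the coefficients and the maximum pole\<close>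

lemma multiplicity_int: "multiplicity (int p) (int a) = multiplicity p a"
  by (simp add: multiplicity_def flip: of_nat_power)

text \<open>\<open>padic_val\<close> refers to lowest terms; cross multiplication shows that any
  fraction gives the same difference.\<close>

lemma padic_val_of_nat_divide:
  assumes p: "prime p" and "0 < a" "0 < b"
  shows "padic_val p (of_nat a / of_nat b) = int (multiplicity p a) - int (multiplicity p b)"
proof -
  obtain c d where cd: "quotient_of (of_nat a / of_nat b) = (c, d)"
    by (cases "quotient_of (of_nat a / of_nat b)")
  have d: "d > 0" using quotient_of_denom_pos [OF cd] .
  have eq: "of_nat a / of_nat b = (of_int c / of_int d :: rat)"
    using quotient_of_div [OF cd] .
  then have "(of_int (int a * d) :: rat) = of_int (c * int b)"
    using assms d by (simp add: field_simps)
  then have e: "int a * d = c * int b" by (simp only: of_int_eq_iff)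
  then have "c \<noteq> 0" using assms d by auto
  have ip: "prime_elem (int p)" using p by simp
  have "multiplicity (int p) (int a * d) = multiplicity p a + multiplicity (int p) d"
    using assms d by (simp add: prime_elem_multiplicity_mult_distrib [OF ip] multiplicity_int)
  moreover have "multiplicity (int p) (c * int b) = multiplicity (int p) c + multiplicity p b"
    using assms \<open>c \<noteq> 0\<close> by (simp add: prime_elem_multiplicity_mult_distrib [OF ip] multiplicity_int)
  ultimately show ?thesis
    unfolding padic_val_def cd using e by simp
qed

lemma Stirling_pos: "0 < k \<Longrightarrow> k \<le> n \<Longrightarrow> 0 < Stirling n k"
proof (induction n arbitrary: k)
  case (Suc n)
  then obtain j where k: "k = Suc j" by (cases k) auto
  show ?case
  proof (cases "k = Suc n")
    case False
    then show ?thesis using Suc.IH [of k] Suc.prems by (simp add: k)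
  qed simp
qed simp

text \<open>
  The coefficient of $x^i$ in $B_{n-k}^{(-k)}(x)$ is $\binom ni S(n-i,k) / \binom nk$, so the condition
  says that the constant coefficient has the least valuation.
\<close>
lemma AMZC_I:
  assumes p: "prime p" and k: "0 < k" "k \<le> n"
    and min: "\<And>i. i \<le> n - k \<Longrightarrow>
      multiplicity p (Stirling n k) \<le> multiplicity p ((n choose i) * Stirling (n - i) k)"
  shows "AMZC p n k"
proof -
  let ?f = "bernoulli_poly (- int k) (n - k)"
  let ?I = "{i. coeff ?f i \<noteq> 0}"
  define v where "v = int (multiplicity p (Stirling n k)) - int (multiplicity p (n choose k))"
  have val: "padic_val p (coeff ?f i) =
      int (multiplicity p ((n choose i) * Stirling (n - i) k)) - int (multiplicity p (n choose k))"
    if "i \<le> n - k" for i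
    unfolding coeff_bernoulli_poly_minus [OF k(2) that]
    using that k by (intro padic_val_of_nat_divide [OF p]) (auto intro!: Stirling_pos)
  \<comment> \<open>Bounds the index set, so that \<open>Min\<close> is over a finite set.\<close>
  have deg: "i \<le> n - k" if "i \<in> ?I" for i
  proof (rule ccontr)
    assume "\<not> i \<le> n - k"
    then have "coeff ?f i = 0"
      unfolding bernoulli_poly_def bernoulli_gf_def
      by (auto simp: fps_mult_nth coeff_sum intro!: sum.neutral)
    with that show False by simp
  qed
  have "Min ((\<lambda>i. padic_val p (coeff ?f i)) ` ?I) = v"
  proof (rule Min_eqI)
    show "finite ((\<lambda>i. padic_val p (coeff ?f i)) ` ?I)"
      using deg by (intro finite_imageI finite_subset [of ?I "{..n - k}"]) auto
    show "v \<le> w" if "w \<in> (\<lambda>i. padic_val p (coeff ?f i)) ` ?I" for w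
      using that deg val min by (fastforce simp: v_def)
    have "coeff ?f 0 \<noteq> 0"
      using coeff_bernoulli_poly_minus [OF k(2), of 0] k Stirling_pos [OF k] by simp
    moreover have "padic_val p (coeff ?f 0) = v"
      using val [of 0] by (simp add: v_def)
    ultimately show "v \<in> (\<lambda>i. padic_val p (coeff ?f i)) ` ?I" by auto
  qed
  then show ?thesis
    using k by (simp add: AMZC_def max_pole_def v_def)
qed

section \<open>Least positive residues and the digit sum formula\<close>

lemma least_pos_residue:
  assumes "0 < (k::nat)" "0 < m"
  shows "(LEAST r. 0 < r \<and> [r = k] (mod m)) = (k - 1) mod m + 1"
proof (rule Least_equality)
  \<comment> \<open>The shift by 1 moves the residues 0, ..., m - 1 to 1, ..., m.\<close>
  have "[(k - 1) mod m + 1 = k - 1 + 1] (mod m)"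
    by (intro cong_add) auto
  then show "0 < (k - 1) mod m + 1 \<and> [(k - 1) mod m + 1 = k] (mod m)"
    using assms by simp
next
  fix r assume r: "0 < r \<and> [r = k] (mod m)"
  then have "[r - 1 + 1 = k - 1 + 1] (mod m)" using assms by simp
  then have "[r - 1 = k - 1] (mod m)" by (simp only: cong_add_rcancel_nat)
  then have "(k - 1) mod m = (r - 1) mod m" by (simp add: cong_def)
  then have "(k - 1) mod m \<le> r - 1" by simp
  then show "(k - 1) mod m + 1 \<le> r" using r by linarith
qed

theorem corollary3p11:
  fixes p n h k k' :: nat
  assumes "prime p"
    and "n \<ge> 1"
    and "p ^ h dvd n"
    and "0 < k" and "k \<le> p ^ h"
    and "k' = (LEAST r. 0 < r \<and> [r = k] (mod (p - 1)))"
    and "int p - 1 dvd int n - int k"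
  shows "AMZC p n k \<and>
    rat_of_nat (multiplicity p (Stirling n k)) =
      (rat_of_nat (digit_sum p k) - rat_of_nat k') / (rat_of_nat p - 1) \<and>
    (rat_of_nat (digit_sum p k) - rat_of_nat k') / (rat_of_nat p - 1) =
      rat_of_int \<lfloor>(rat_of_nat (digit_sum p k) - 1) / (rat_of_nat p - 1)\<rfloor>"
proof -
  note p = \<open>prime p\<close>
  have p2: "p \<ge> 2" using p by (rule prime_ge_2_nat)
  define q where "q = (k - 1) div (p - 1)"
  have kn: "k \<le> n" using assms dvd_imp_le [of "p ^ h" n] by linarith
  have "int (p - 1) dvd int (n - k)" using assms(7) kn p2 by (simp add: of_nat_diff)
  then have dvd: "(p - 1) dvd (n - k)" by (simp only: int_dvd_int_iff)
  have S: "Stirling n k > 0" using assms(4) kn by (rule Stirling_pos)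
  have mult_fact: "multiplicity p (fact k * m) = multiplicity p (fact k :: nat) + multiplicity p m"
    if "m > 0" for m
    using p that by (simp add: prime_elem_multiplicity_mult_distrib)
  have "multiplicity p (fact k * Stirling n k) = q"
    using fact_mult_Stirling_dvd [OF p assms(3-5), of n]
      not_dvd_fact_mult_Stirling [OF p assms(3-5) kn dvd]
    unfolding q_def by (intro multiplicity_eqI) simp_all
  then have val: "multiplicity p (fact k :: nat) + multiplicity p (Stirling n k) = q"
    using mult_fact [OF S] by simp
  have amzc: "AMZC p n k"
  proof (rule AMZC_I [OF p assms(4) kn])
    fix i assume i: "i \<le> n - k"
    then have "k \<le> n - i" using kn by linarith
    then have pos: "(n choose i) * Stirling (n - i) k > 0"
      using assms(4) i kn by (simp add: Stirling_pos)
    \<comment> \<open>The coefficient of x^i corresponds to the moment of order r = n - i.\<close>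
    have "(n choose (n - i)) = (n choose i)"
      using i kn by (intro binomial_symmetric [symmetric]) simp
    then have "p ^ q dvd fact k * ((n choose i) * Stirling (n - i) k)"
      using fact_mult_Stirling_dvd [OF p assms(3-5), of "n - i"] by (simp add: q_def mult_ac)
    then have "q \<le> multiplicity p (fact k * ((n choose i) * Stirling (n - i) k))"
      using pos p2 by (intro multiplicity_geI) auto
    then show "multiplicity p (Stirling n k) \<le> multiplicity p ((n choose i) * Stirling (n - i) k)"
      using val mult_fact [OF pos] by linarith
  qed
  have k': "k' = (k - 1) mod (p - 1) + 1"
    using assms(4,6) p2 least_pos_residue [of k "p - 1"] by simp
  define v where "v = multiplicity p (Stirling n k)"
  have "(p - 1) * q + k' = k"
    unfolding q_def k' using assms(4) by simp
  moreover have "(p - 1) * q = (p - 1) * multiplicity p (fact k :: nat) + (p - 1) * v"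
    using val by (simp add: v_def flip: add_mult_distrib2)
  \<comment> \<open>Legendre's formula and k = (p-1) q + k' are compared, with q the valuation of k!
    S(n,k).\<close>
  ultimately have ds: "digit_sum p k = (p - 1) * v + k'"
    using multiplicity_fact_digit_sum [OF p, of k] by linarith
  define d where "d = rat_of_nat p - 1"
  have d: "d > 0" "rat_of_nat (p - 1) = d" using p2 by (simp_all add: d_def of_nat_diff)
  have eq: "rat_of_nat v = (rat_of_nat (digit_sum p k) - rat_of_nat k') / d"
    using d by (simp add: ds)
  \<comment> \<open>The floor is v because its argument is v + (k'-1)/(p-1) with 0 \<le> k' - 1 < p
    - 1.\<close>
  have "k' - 1 < p - 1" unfolding k' using p2 by simp
  then have "rat_of_nat (k' - 1) < rat_of_nat (p - 1)" by (simp only: of_nat_less_iff)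
  moreover have "rat_of_nat (k' - 1) = rat_of_nat k' - 1" by (simp add: k')
  ultimately have "\<lfloor>(rat_of_nat (digit_sum p k) - 1) / d\<rfloor> = int v"
    using d by (intro floor_unique) (simp_all add: ds k' field_simps)
  with eq have "(rat_of_nat (digit_sum p k) - rat_of_nat k') / d =
      rat_of_int \<lfloor>(rat_of_nat (digit_sum p k) - 1) / d\<rfloor>" by simp
  with eq show ?thesis unfolding v_def d_def using amzc by simp
qed

end
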